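(* For every $\varepsilon>0$ there exists an integer $C(\varepsilon)\ge3$ such that for all integers $d\ge C(\varepsilon)$ and $N\ge C(\varepsilon)d$, \[ \frac{1}{\#\Psi}\cdot\#\left\{(\vec{\mathbf v},\vec{\mathbf w})\in\Psi:\ \sin\big(\widehat{\vec{\mathbf v},\vec{\mathbf w}}\big)\in\left[\tfrac{\sqrt7}{4}-\varepsilon,\ \tfrac{\sqrt7}{4}+\varepsilon\right]\right\}\ge1-\varepsilon, \] where $\widehat{\vec{\mathbf v},\vec{\mathbf w}}$ denotes the angle between the two rays.
   Context: For integers $d,N\ge1$ let $\mathcal W=[0,N]^d\cap\mathbb Z^d$. Two points $\mathbf v,\mathbf w\in\mathcal W$ are visible from each other if $\gcd(v_1-w_1,\dots,v_d-w_d)=1$, and $\Omega$ is the set of ordered pairs $(\mathbf v,\mathbf w)\in\mathcal W\times\mathcal W$ of points visible from each other. For $\mathbf v\in\mathcal W$, $\vec{\mathbf v}$ denotes the ray starting at the origin and passing through $\mathbf v$. $\Psi$ is the set of pairs of rays $(\vec{\mathbf v},\vec{\mathbf w})$ with $(\mathbf v,\mathbf w)\in\Omega$. *)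

theory Defs
  imports "HOL-Analysis.Analysis"
begin

text \<open>
  The dimension \<open>d\<close> is quantified inside the statement, so points and vectors of dimension \<open>d\<close>
  are functions on the index set \<open>{..<d}\<close>.
\<close>

definition lattice_box :: "nat \<Rightarrow> nat \<Rightarrow> (nat \<Rightarrow> int) set" where
  "lattice_box d N = {..<d} \<rightarrow>\<^sub>E {0..int N}"

definition visible :: "nat \<Rightarrow> (nat \<Rightarrow> int) \<Rightarrow> (nat \<Rightarrow> int) \<Rightarrow> bool" where
  "visible d v w \<longleftrightarrow> (GCD i\<in>{..<d}. v i - w i) = 1"

definition Omega :: "nat \<Rightarrow> nat \<Rightarrow> ((nat \<Rightarrow> int) \<times> (nat \<Rightarrow> int)) set" where
  "Omega d N = {(v, w) \<in> lattice_box d N \<times> lattice_box d N. visible d v w}"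

text \<open>
  Rays are point sets, so points on the same half-line give the same ray.
  The origin gives the degenerate ray consisting of the origin only.
\<close>

definition ray :: "nat \<Rightarrow> (nat \<Rightarrow> real) \<Rightarrow> (nat \<Rightarrow> real) set" where
  "ray d x = {(\<lambda>i\<in>{..<d}. t * x i) | t. t \<ge> 0}"

definition lattice_ray :: "nat \<Rightarrow> (nat \<Rightarrow> int) \<Rightarrow> (nat \<Rightarrow> real) set" where
  "lattice_ray d v = ray d (\<lambda>i. real_of_int (v i))"

definition Psi :: "nat \<Rightarrow> nat \<Rightarrow> ((nat \<Rightarrow> real) set \<times> (nat \<Rightarrow> real) set) set" where
  "Psi d N = (\<lambda>(v, w). (lattice_ray d v, lattice_ray d w)) ` Omega d N"

text \<open>
  Since \<open>a / 0 = 0\<close>, the angle with the zero vector is \<open>pi / 2\<close> by convention.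
\<close>

definition vec_angle :: "nat \<Rightarrow> (nat \<Rightarrow> real) \<Rightarrow> (nat \<Rightarrow> real) \<Rightarrow> real" where
  "vec_angle d x y = arccos ((\<Sum>i<d. x i * y i) / (L2_set x {..<d} * L2_set y {..<d}))"

text \<open>
  The angle between two rays is the angle between any two vectors spanning them;
  the lemma \<open>ray_angle_ray\<close> below shows that it does not depend on the choice.
\<close>

definition ray_angle :: "nat \<Rightarrow> (nat \<Rightarrow> real) set \<Rightarrow> (nat \<Rightarrow> real) set \<Rightarrow> real" where
  "ray_angle d R S =
     (THE \<theta>. \<forall>x y. R = ray d x \<longrightarrow> S = ray d y \<longrightarrow> \<theta> = vec_angle d x y)"

lemma ray_eq_imp_scaled:
  assumes "ray d x = ray d y"
  obtains t where "t > 0" "\<And>i. i < d \<Longrightarrow> y i = t * x i"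
proof -
  have sub: "\<exists>t\<ge>0. \<forall>i<d. b i = t * a i" if "ray d a = ray d b" for a b
  proof -
    have "(\<lambda>i\<in>{..<d}. 1 * b i) \<in> ray d b"
      unfolding ray_def by (intro CollectI exI[of _ "1::real"]) simp
    then have "(\<lambda>i\<in>{..<d}. 1 * b i) \<in> ray d a"
      using that by simp
    then obtain t where t: "t \<ge> 0" "(\<lambda>i\<in>{..<d}. 1 * b i) = (\<lambda>i\<in>{..<d}. t * a i)"
      unfolding ray_def by blast
    have "b i = t * a i" if "i < d" for i
      using fun_cong[OF t(2), of i] that by simp
    with t(1) show ?thesis by blast
  qed
  obtain t where t: "t \<ge> 0" "\<forall>i<d. y i = t * x i" using sub[OF assms] by blast
  obtain s where s: "s \<ge> 0" "\<forall>i<d. x i = s * y i" using sub[OF assms[symmetric]] by blast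
  show ?thesis
  proof (cases "t = 0")
    case True
    have y0: "y i = 0" if "i < d" for i using t(2) that True by auto
    have "x i = 0" if "i < d" for i using s(2) y0[OF that] that by auto
    with y0 have "y i = 1 * x i" if "i < d" for i using that by simp
    then show ?thesis by (rule that[OF zero_less_one])
  next
    case False
    with t(1) have "t > 0" by simp
    then show ?thesis by (rule that) (use t(2) in blast)
  qed
qed

lemma vec_angle_scaled:
  assumes "s > 0" "t > 0"
    and "\<And>i. i < d \<Longrightarrow> x' i = s * x i" "\<And>i. i < d \<Longrightarrow> y' i = t * y i"
  shows "vec_angle d x' y' = vec_angle d x y"
proof -
  have L: "L2_set x' {..<d} = s * L2_set x {..<d}" "L2_set y' {..<d} = t * L2_set y {..<d}"
    using assms by (auto simp: L2_set_right_distrib intro!: L2_set_cong)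
  have "(\<Sum>i<d. x' i * y' i) = (s * t) * (\<Sum>i<d. x i * y i)"
    unfolding sum_distrib_left using assms by (intro sum.cong) (auto simp: mult_ac)
  then show ?thesis
    unfolding vec_angle_def L using assms(1,2) by (simp add: mult_ac)
qed

lemma ray_angle_ray: "ray_angle d (ray d x) (ray d y) = vec_angle d x y"
  unfolding ray_angle_def
proof (rule the_equality)
  show "\<forall>x' y'. ray d x = ray d x' \<longrightarrow> ray d y = ray d y' \<longrightarrow> vec_angle d x y = vec_angle d x' y'"
  proof (intro allI impI)
    fix x' y' assume eq: "ray d x = ray d x'" "ray d y = ray d y'"
    obtain s where s: "s > 0" "\<And>i. i < d \<Longrightarrow> x' i = s * x i"
      using ray_eq_imp_scaled[OF eq(1)] by blast
    obtain t where t: "t > 0" "\<And>i. i < d \<Longrightarrow> y' i = t * y i"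
      using ray_eq_imp_scaled[OF eq(2)] by blast
    show "vec_angle d x y = vec_angle d x' y'"
      using vec_angle_scaled[OF s(1) t(1) s(2) t(2)] by simp
  qed
qed blast

end

theory Submission
  imports Defs
begin

text \<open>
  Scale coordinates by \<open>1/N\<close>. By Chebyshev's inequality, for all but a fraction \<open>O(1/d)\<close> of the pairs
  \<open>(v, w)\<close> of lattice points the averages of \<open>v i * w i\<close>, \<open>(v i)\<^sup>2\<close> and \<open>(w i)\<^sup>2\<close> are close to
  \<open>1/4\<close>, \<open>1/3\<close> and \<open>1/3\<close>, so that the cosine of the angle is close to \<open>3/4\<close> and its sine to
  \<open>sqrt 7 / 4\<close>. Every exceptional pair of rays comes from an exceptional pair of points. Conversely,
  distinct primitive points span distinct rays, and all but a fraction \<open>O((2/3) ^ d)\<close> of the pairs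
  consist of two primitive points visible from each other, so \<open>Psi d N\<close> has at least
  \<open>(N + 1) ^ (2 * d) / 2\<close> elements.
\<close>

section \<open>Second moments and Chebyshev's inequality on product sets\<close>

text \<open>Independent centred coordinates have additive variances, and each variance is at most 1.
  The summand may depend on \<open>i\<close> because, for a pair of points, one point is fixed and
  supplies the coefficients.\<close>

lemma sum_PiE_square_le:
  fixes f :: "nat \<Rightarrow> 'a \<Rightarrow> real"
  assumes "finite A"
    and "\<And>i. i < d \<Longrightarrow> (\<Sum>a\<in>A. f i a) = 0"
    and "\<And>i a. i < d \<Longrightarrow> a \<in> A \<Longrightarrow> \<bar>f i a\<bar> \<le> 1"
  shows "(\<Sum>z\<in>{..<d} \<rightarrow>\<^sub>E A. (\<Sum>i<d. f i (z i))\<^sup>2) \<le> real d * real (card A) ^ d"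
  using assms(2,3)
proof (induction d)
  case 0
  then show ?case by simp
next
  case (Suc d)
  let ?B = "{..<d} \<rightarrow>\<^sub>E A"
  let ?S = "\<lambda>z. \<Sum>i<d. f i (z i)"
  have cardB: "real (card ?B) = real (card A) ^ d" by (simp add: card_PiE)
  have inj: "inj_on (\<lambda>(a, z). z(d := a)) (A \<times> ?B)"
    using inj_combinator[of d "{..<d}" "\<lambda>_. A"] by simp
  have upd: "(\<Sum>i<Suc d. f i ((z(d := a)) i)) = ?S z + f d a" for z a
    by (auto intro!: sum.cong)
  have box: "{..<Suc d} \<rightarrow>\<^sub>E A = (\<lambda>(a, z). z(d := a)) ` (A \<times> ?B)"
    by (simp add: lessThan_Suc PiE_insert_eq)
  have "(\<Sum>z\<in>{..<Suc d} \<rightarrow>\<^sub>E A. (\<Sum>i<Suc d. f i (z i))\<^sup>2)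
      = (\<Sum>(a, z)\<in>A \<times> ?B. (?S z + f d a)\<^sup>2)"
    by (simp only: box sum.reindex[OF inj] o_def) (simp only: case_prod_unfold upd)
  also have "\<dots> = (\<Sum>a\<in>A. \<Sum>z\<in>?B. (?S z + f d a)\<^sup>2)"
    by (rule sum.cartesian_product[symmetric])
  also have "\<dots> = (\<Sum>a\<in>A. (\<Sum>z\<in>?B. (?S z)\<^sup>2) + f d a * (2 * (\<Sum>z\<in>?B. ?S z)) + real (card ?B) * (f d a)\<^sup>2)"
  proof (rule sum.cong[OF refl])
    fix a
    have "(\<Sum>z\<in>?B. (?S z + f d a)\<^sup>2) = (\<Sum>z\<in>?B. (?S z)\<^sup>2 + f d a * (2 * ?S z) + (f d a)\<^sup>2)"
      by (simp add: power2_sum algebra_simps)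
    also have "\<dots> = (\<Sum>z\<in>?B. (?S z)\<^sup>2) + f d a * (2 * (\<Sum>z\<in>?B. ?S z)) + real (card ?B) * (f d a)\<^sup>2"
      by (simp only: sum.distrib sum_distrib_left sum_constant)
    finally show "(\<Sum>z\<in>?B. (?S z + f d a)\<^sup>2)
      = (\<Sum>z\<in>?B. (?S z)\<^sup>2) + f d a * (2 * (\<Sum>z\<in>?B. ?S z)) + real (card ?B) * (f d a)\<^sup>2" .
  qed
  also have "\<dots> = real (card A) * (\<Sum>z\<in>?B. (?S z)\<^sup>2) + (\<Sum>a\<in>A. f d a) * (2 * (\<Sum>z\<in>?B. ?S z))
      + real (card ?B) * (\<Sum>a\<in>A. (f d a)\<^sup>2)"
    by (simp only: sum.distrib sum_constant flip: sum_distrib_left[of "real (card ?B)"] sum_distrib_right[of _ _ "2 * (\<Sum>z\<in>?B. ?S z)"])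
  \<comment> \<open>The cross term vanishes because \<open>f d\<close> sums to 0 over
    \<open>A\<close>.\<close>
  also have "\<dots> \<le> real (card A) * (real d * real (card A) ^ d) + 0
      + real (card A) ^ d * real (card A)"
  proof (intro add_mono mult_left_mono)
    show "(\<Sum>z\<in>?B. (?S z)\<^sup>2) \<le> real d * real (card A) ^ d" using Suc by simp
    have "(\<Sum>a\<in>A. (f d a)\<^sup>2) \<le> (\<Sum>a\<in>A. 1)"
      using Suc.prems(2) by (intro sum_mono) (simp add: abs_square_le_1)
    then show "real (card ?B) * (\<Sum>a\<in>A. (f d a)\<^sup>2) \<le> real (card A) ^ d * real (card A)"
      unfolding cardB by (intro mult_left_mono) auto
  qed (use Suc.prems(1) in auto)
  finally show ?case by (simp add: algebra_simps)
qed

text \<open>Chebyshev's inequality: each exceptional point contributes at least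
  \<open>(\<eta> * d)\<^sup>2\<close> to the second moment.\<close>

lemma card_PiE_deviation_le:
  fixes f :: "nat \<Rightarrow> 'a \<Rightarrow> real" and \<eta> :: real
  assumes "finite A" "\<eta> > 0" "d > 0"
    and "\<And>i. i < d \<Longrightarrow> (\<Sum>a\<in>A. f i a) = 0"
    and "\<And>i a. i < d \<Longrightarrow> a \<in> A \<Longrightarrow> \<bar>f i a\<bar> \<le> 1"
  shows "real (card {z \<in> {..<d} \<rightarrow>\<^sub>E A. \<bar>\<Sum>i<d. f i (z i)\<bar> > \<eta> * d})
    \<le> real (card A) ^ d / (\<eta>\<^sup>2 * d)"
proof -
  let ?B = "{..<d} \<rightarrow>\<^sub>E A"
  let ?S = "\<lambda>z. \<Sum>i<d. f i (z i)"
  let ?D = "{z \<in> ?B. \<bar>?S z\<bar> > \<eta> * d}"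
  have fin: "finite ?B" using assms(1) by (intro finite_PiE) auto
  have "real (card ?D) * (\<eta> * d)\<^sup>2 = (\<Sum>z\<in>?D. (\<eta> * d)\<^sup>2)" by simp
  also have "\<dots> \<le> (\<Sum>z\<in>?D. (?S z)\<^sup>2)"
  proof (rule sum_mono)
    fix z assume "z \<in> ?D"
    then have "(\<eta> * d)\<^sup>2 \<le> \<bar>?S z\<bar>\<^sup>2" using assms by (intro power_mono) auto
    then show "(\<eta> * d)\<^sup>2 \<le> (?S z)\<^sup>2" by simp
  qed
  also have "\<dots> \<le> (\<Sum>z\<in>?B. (?S z)\<^sup>2)" using fin by (intro sum_mono2) auto
  also have "\<dots> \<le> d * real (card A) ^ d" using assms by (intro sum_PiE_square_le) auto
  finally have "real (card ?D) * (\<eta>\<^sup>2 * d) * d \<le> real (card A) ^ d * d"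
    by (simp add: power2_eq_square mult_ac)
  then have "real (card ?D) * (\<eta>\<^sup>2 * d) \<le> real (card A) ^ d"
    using assms(3) by (subst (asm) mult_le_cancel_right) auto
  then show ?thesis using assms by (simp add: pos_le_divide_eq)
qed

section \<open>Counting the points not visible from a given point\<close>

text \<open>Within one residue class modulo \<open>g\<close>, a number is determined by its quotient
  by \<open>g\<close>, which lies between 0 and \<open>N div g\<close>.\<close>

lemma card_residue_class_le:
  fixes a :: int and g N :: nat
  assumes "g > 0"
  shows "card {x \<in> {0..int N}. int g dvd x - a} \<le> N div g + 1"
proof -
  have "inj_on (\<lambda>x. x div int g) {x \<in> {0..int N}. int g dvd x - a}"
  proof (rule inj_onI)
    fix x y
    assume xy: "x \<in> {x \<in> {0..int N}. int g dvd x - a}" "y \<in> {x \<in> {0..int N}. int g dvd x - a}"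
      and eq: "x div int g = y div int g"
    from xy have "int g dvd (x - a) - (y - a)" by (blast intro: dvd_diff)
    then have "x mod int g = y mod int g" by (simp add: mod_eq_dvd_iff)
    with eq show "x = y" by (metis div_mult_mod_eq)
  qed
  moreover have "(\<lambda>x. x div int g) ` {x \<in> {0..int N}. int g dvd x - a} \<subseteq> {0..int (N div g)}"
    using assms by (auto simp: zdiv_int pos_imp_zdiv_nonneg_iff intro!: zdiv_mono1)
  ultimately have "card {x \<in> {0..int N}. int g dvd x - a} \<le> card {0..int (N div g)}"
    by (intro card_inj_on_le[where f = "\<lambda>x. x div int g"]) auto
  then show ?thesis by simp
qed

text \<open>The differing coordinate \<open>j\<close> excludes the gcd 0 and bounds the gcd by
  \<open>\<bar>v j - w j\<bar>\<close>, so that only finitely many moduli need to be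
  considered.\<close>

lemma not_visible_imp_dvd:
  assumes "\<not> visible d v w" "\<And>i. i < d \<Longrightarrow> v i \<in> {0..int N}" "\<And>i. i < d \<Longrightarrow> w i \<in> {0..int N}"
    and "j < d" "v j \<noteq> w j"
  shows "\<exists>g\<in>{2..N}. \<forall>i<d. int g dvd v i - w i"
proof -
  let ?G = "GCD i\<in>{..<d}. v i - w i"
  have dvd: "?G dvd v i - w i" if "i < d" for i using that by (intro Gcd_dvd) auto
  have "?G \<noteq> 0" using dvd[OF assms(4)] assms(5) by (metis dvd_0_left_iff right_minus_eq)
  moreover have "?G \<ge> 0" by simp
  moreover have "?G \<noteq> 1" using assms(1) by (simp add: visible_def)
  ultimately have ge: "?G \<ge> 2" by linarith
  have "?G \<le> \<bar>v j - w j\<bar>"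
    using dvd[OF assms(4)] assms(5) by (intro zdvd_imp_le) auto
  also have "\<dots> \<le> int N" using assms(2,3)[OF assms(4)] by auto
  finally have le: "?G \<le> int N" .
  show ?thesis
    by (rule bexI[of _ "nat ?G"]) (use ge le dvd in auto)
qed

text \<open>Comparison with the telescoping terms 1/n - 1/(n+1); the sharper bound 1 - 1/n carries
  the induction.\<close>

lemma sum_inverse_squares_le: "(\<Sum>g = 2..n. 1 / (real g)\<^sup>2) \<le> 1"
proof -
  have "(\<Sum>g = 2..n. 1 / (real g)\<^sup>2) \<le> 1 - 1 / real n" if "n \<ge> 1"
    using that
  proof (induction n rule: dec_induct)
    case (step n)
    have "1 / (real (Suc n))\<^sup>2 \<le> 1 / real n - 1 / real (Suc n)"
    proof -
      have "1 / (real (Suc n))\<^sup>2 \<le> 1 / (real n * real (Suc n))"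
        using step(1) unfolding power2_eq_square
        by (intro divide_left_mono mult_right_mono) auto
      also have "\<dots> = 1 / real n - 1 / real (Suc n)" using step(1) by (simp add: field_simps)
      finally show ?thesis .
    qed
    then show ?case using step by simp
  qed simp
  then show ?thesis by (cases "n = 0") (simp, fastforce intro: order_trans)
qed

lemma finite_lattice_box: "finite (lattice_box d N)"
  unfolding lattice_box_def by (intro finite_PiE) auto

lemma card_lattice_box: "card (lattice_box d N) = (N + 1) ^ d"
  by (simp add: lattice_box_def card_PiE nat_add_distrib)

text \<open>
  If \<open>g\<close> divides all \<open>v i - w i\<close>, then \<open>v\<close> is confined to at most \<open>(N div g + 1) ^ d\<close> points. As
  \<open>N div g + 1\<close> is at most both \<open>2/3 * (N + 1)\<close> and \<open>2 / g * (N + 1)\<close>, using the second bound for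
  two of the factors makes the sum over \<open>g\<close> converge. The remaining unit of the constant 5 pays
  for \<open>v = w\<close>.
\<close>
lemma card_not_visible_le:
  assumes "d \<ge> 2" "N \<ge> 2" and w: "\<And>i. i < d \<Longrightarrow> w i \<in> {0..int N}"
  shows "real (card {v \<in> lattice_box d N. \<not> visible d v w}) \<le> 5 * (2/3) ^ (d - 2) * (real N + 1) ^ d"
proof -
  let ?R = "\<lambda>g. PiE {..<d} (\<lambda>i. {x \<in> {0..int N}. int g dvd x - w i})"
  have split_power: "x ^ (d - 2) * x\<^sup>2 = x ^ d" for x :: real
    using assms(1) by (metis le_add_diff_inverse2 power_add)
  have fin: "finite (?R g)" for g
    by (rule finite_PiE) (auto intro: finite_subset[of _ "{0..int N}"])
  \<comment> \<open>The point \<open>w\<close> is not assumed extensional, so that the zero function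
    is allowed; the box point that agrees with it is therefore its restriction.\<close>
  have sub: "{v \<in> lattice_box d N. \<not> visible d v w} \<subseteq> {restrict w {..<d}} \<union> (\<Union>g\<in>{2..N}. ?R g)"
  proof
    fix v assume v: "v \<in> {v \<in> lattice_box d N. \<not> visible d v w}"
    show "v \<in> {restrict w {..<d}} \<union> (\<Union>g\<in>{2..N}. ?R g)"
    proof (cases "\<exists>j<d. v j \<noteq> w j")
      case True
      then obtain j where "j < d" "v j \<noteq> w j" by blast
      moreover have "v i \<in> {0..int N}" if "i < d" for i
        using v that by (auto simp: lattice_box_def PiE_iff)
      ultimately obtain g where "g \<in> {2..N}" "\<forall>i<d. int g dvd v i - w i"
        using not_visible_imp_dvd[of d v w N] v w by blast
      then show ?thesis using v by (auto simp: lattice_box_def PiE_iff)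
    next
      case False
      have "v \<in> extensional {..<d}" using v by (simp add: lattice_box_def PiE_def)
      then have "v = restrict w {..<d}"
        by (rule extensionalityI[OF _ restrict_extensional]) (use False in auto)
      then show ?thesis by simp
    qed
  qed
  have R: "real (card (?R g)) \<le> 4 * (2/3) ^ (d - 2) * (real N + 1) ^ d * (1 / (real g)\<^sup>2)"
    if g: "g \<in> {2..N}" for g
  proof -
    have "card (?R g) = (\<Prod>i<d. card {x \<in> {0..int N}. int g dvd x - w i})"
      by (simp add: card_PiE)
    also have "\<dots> \<le> (\<Prod>i<d. N div g + 1)"
      using g by (intro prod_mono conjI card_residue_class_le) auto
    finally have "card (?R g) \<le> (N div g + 1) ^ d" by simp
    then have "real (card (?R g)) \<le> real ((N div g + 1) ^ d)" by (simp only: of_nat_le_iff)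
    also have "\<dots> = (real (N div g) + 1) ^ d" by (simp add: add.commute)
    also have "\<dots> \<le> (real N / real g + 1) ^ d"
      by (intro power_mono add_mono of_nat_div_le_of_nat) auto
    also have "\<dots> = (real N / real g + 1) ^ (d - 2) * (real N / real g + 1) ^ 2"
      by (rule split_power[symmetric])
    also have "\<dots> \<le> (2/3 * (real N + 1)) ^ (d - 2) * (2 / real g * (real N + 1)) ^ 2"
    proof (intro mult_mono power_mono)
      \<comment> \<open>The constant 2/3 fits because N/2 + 1 \<le> 2/3 (N + 1) is equivalent to N
        \<ge> 2.\<close>
      have "real N / real g \<le> real N / 2" using g by (intro divide_left_mono) auto
      then show "real N / real g + 1 \<le> 2/3 * (real N + 1)" using assms(2) by simp
      \<comment> \<open>Since g \<le> N, the summand 1 is absorbed by a second copy of N/g.\<close>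
      have "1 \<le> real N / real g" using g by (simp add: le_divide_eq)
      moreover have "2 / real g * (real N + 1) = real N / real g + real N / real g + 2 / real g"
        by (simp add: add_divide_distrib distrib_left)
      moreover have "0 \<le> 2 / real g" by simp
      ultimately show "real N / real g + 1 \<le> 2 / real g * (real N + 1)" by linarith
    qed auto
    also have "\<dots> = 4 * (2/3) ^ (d - 2) * ((real N + 1) ^ (d - 2) * (real N + 1) ^ 2) * (1 / (real g)\<^sup>2)"
      unfolding power_mult_distrib power_divide by simp
    also have "(real N + 1) ^ (d - 2) * (real N + 1) ^ 2 = (real N + 1) ^ d"
      by (rule split_power)
    finally show ?thesis .
  qed
  \<comment> \<open>For N \<ge> 2 each factor 2/3 (N + 1) is at least 2, so the single point equal
    to \<open>w\<close> on the index set costs no more than this bound.\<close>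
  have one: "1 \<le> (2/3) ^ (d - 2) * (real N + 1) ^ d"
  proof -
    have "(1::real) \<le> (2/3 * (real N + 1)) ^ (d - 2) * (real N + 1) ^ 2"
      using assms(2) by (intro mult_ge1_I[OF one_le_power one_le_power]) auto
    also have "\<dots> = (2/3) ^ (d - 2) * ((real N + 1) ^ (d - 2) * (real N + 1) ^ 2)"
      by (simp only: power_mult_distrib mult.assoc)
    also have "(real N + 1) ^ (d - 2) * (real N + 1) ^ 2 = (real N + 1) ^ d"
      by (rule split_power)
    finally show ?thesis .
  qed
  have "card {v \<in> lattice_box d N. \<not> visible d v w} \<le> card ({restrict w {..<d}} \<union> (\<Union>g\<in>{2..N}. ?R g))"
    using fin sub by (intro card_mono) auto
  also have "\<dots> \<le> 1 + card (\<Union>g\<in>{2..N}. ?R g)"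
    by (rule order_trans[OF card_Un_le]) simp
  also have "\<dots> \<le> 1 + (\<Sum>g = 2..N. card (?R g))"
    by (intro add_left_mono card_UN_le) simp
  finally have "real (card {v \<in> lattice_box d N. \<not> visible d v w}) \<le> real (1 + (\<Sum>g = 2..N. card (?R g)))"
    by (simp only: of_nat_le_iff)
  also have "\<dots> = 1 + (\<Sum>g = 2..N. real (card (?R g)))" by simp
  also have "\<dots> \<le> (2/3) ^ (d - 2) * (real N + 1) ^ d
      + (\<Sum>g = 2..N. 4 * (2/3) ^ (d - 2) * (real N + 1) ^ d * (1 / (real g)\<^sup>2))"
    by (intro add_mono one sum_mono R)
  also have "(\<Sum>g = 2..N. 4 * (2/3) ^ (d - 2) * (real N + 1) ^ d * (1 / (real g)\<^sup>2))
      = 4 * (2/3) ^ (d - 2) * (real N + 1) ^ d * (\<Sum>g = 2..N. 1 / (real g)\<^sup>2)"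
    by (rule sum_distrib_left[symmetric])
  also have "\<dots> \<le> 4 * (2/3) ^ (d - 2) * (real N + 1) ^ d * 1"
    by (intro mult_left_mono sum_inverse_squares_le) auto
  finally show ?thesis by (simp add: mult_ac)
qed

section \<open>Primitive points, their rays, and a lower bound for the number of pairs of
  rays\<close>

text \<open>Visibility from the origin means that the coordinates have gcd 1. Pulling
  \<open>b\<close> out of the gcd of the products leaves \<open>b\<close> up to sign.\<close>

lemma dvd_if_dvd_mult_primitive:
  assumes "visible d v (\<lambda>_. 0)" "\<And>j. j < d \<Longrightarrow> a dvd b * v j"
  shows "a dvd b"
proof -
  have "a dvd (GCD j\<in>{..<d}. b * v j)" using assms(2) by (intro Gcd_greatest) auto
  also have "(GCD j\<in>{..<d}. b * v j) = normalize (b * (GCD j\<in>{..<d}. v j))"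
    using Gcd_mult[of b "v ` {..<d}"] by (simp add: image_image)
  finally show ?thesis using assms(1) by (simp add: visible_def)
qed

text \<open>Points on the same ray are proportional, and cross-multiplying eliminates the real
  factor. Primitivity then makes corresponding coordinates divide each other, and nonnegative
  integers that do so are equal.\<close>

lemma lattice_ray_inj_on_primitive:
  "inj_on (lattice_ray d) {v \<in> lattice_box d N. visible d v (\<lambda>_. 0)}"
proof (rule inj_onI)
  fix v w
  assume v: "v \<in> {v \<in> lattice_box d N. visible d v (\<lambda>_. 0)}"
    and w: "w \<in> {v \<in> lattice_box d N. visible d v (\<lambda>_. 0)}"
    and eq: "lattice_ray d v = lattice_ray d w"
  obtain t where t: "t > 0" "\<And>i. i < d \<Longrightarrow> real_of_int (w i) = t * real_of_int (v i)"
    using ray_eq_imp_scaled[OF eq[unfolded lattice_ray_def]] by blast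
  have cross: "w i * v j = v i * w j" if "i < d" "j < d" for i j
  proof -
    have "real_of_int (w i * v j) = real_of_int (v i * w j)" using t(2) that by simp
    then show ?thesis by (simp only: of_int_eq_iff)
  qed
  have "v i = w i" if i: "i < d" for i
  proof -
    have "v i dvd w i"
      by (rule dvd_if_dvd_mult_primitive[of d v]) (use v cross[OF i] in auto)
    moreover have "w i dvd v i"
      by (rule dvd_if_dvd_mult_primitive[of d w]) (use w cross[OF i, symmetric] in auto)
    moreover have "v i \<ge> 0" "w i \<ge> 0" using v w i by (auto simp: lattice_box_def PiE_iff)
    ultimately show ?thesis by (rule zdvd_antisym_nonneg[rotated 2])
  qed
  then show "v = w"
    using v w by (intro PiE_ext[of v "{..<d}" "\<lambda>_. {0..int N}"]) (auto simp: lattice_box_def)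
qed

text \<open>Counts fibrewise over the second component, which turns a bound uniform in
  \<open>w\<close> into a bound for pairs.\<close>

lemma card_pairs_le:
  fixes K :: real
  assumes "finite A" "finite B" "\<And>w. w \<in> B \<Longrightarrow> real (card {v \<in> A. P v w}) \<le> K"
  shows "real (card {(v, w) \<in> A \<times> B. P v w}) \<le> card B * K"
proof -
  have "{(v, w) \<in> A \<times> B. P v w} = prod.swap ` (SIGMA w:B. {v \<in> A. P v w})" by auto
  then have "card {(v, w) \<in> A \<times> B. P v w} = card (SIGMA w:B. {v \<in> A. P v w})"
    by (simp add: card_image)
  also have "\<dots> = (\<Sum>w\<in>B. card {v \<in> A. P v w})" using assms by (simp add: card_SigmaI)
  finally have "real (card {(v, w) \<in> A \<times> B. P v w}) = (\<Sum>w\<in>B. real (card {v \<in> A. P v w}))" by simp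
  also have "\<dots> \<le> (\<Sum>w\<in>B. K)" by (intro sum_mono assms)
  finally show ?thesis by simp
qed

lemma card_pairs_snd_le:
  fixes K :: real
  assumes "finite A" "finite B" "real (card {w \<in> B. P w}) \<le> K"
  shows "real (card {(v, w) \<in> A \<times> B. P w}) \<le> card A * K"
proof -
  have "{(v, w) \<in> A \<times> B. P w} = A \<times> {w \<in> B. P w}" by auto
  then show ?thesis using assms by (simp add: card_cartesian_product mult_left_mono)
qed

lemma finite_Psi: "finite (Psi d N)"
  unfolding Psi_def Omega_def
  by (intro finite_imageI finite_subset[OF _ finite_cartesian_product[OF finite_lattice_box finite_lattice_box]]) auto

text \<open>On visible pairs of primitive points the map to pairs of rays is injective. The
  remaining pairs lie in three sets, each of proportion at most \<open>5 * (2/3) ^ (d - 2)\<close>;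
  the last hypothesis makes their total at most one half.\<close>

lemma card_Psi_ge:
  assumes "d \<ge> 2" "N \<ge> 2" "15 * (2/3 :: real) ^ (d - 2) \<le> 1/2"
  shows "real (card (Psi d N)) \<ge> ((real N + 1) ^ d)\<^sup>2 / 2"
proof -
  let ?L = "lattice_box d N"
  let ?M = "(real N + 1) ^ d"
  let ?K = "5 * (2/3) ^ (d - 2) * ?M"
  let ?prim = "\<lambda>v. visible d v (\<lambda>_. 0)"
  let ?V = "{v \<in> ?L. ?prim v}"
  let ?G = "{(v, w) \<in> ?V \<times> ?V. visible d v w}"
  let ?B1 = "{(v, w) \<in> ?L \<times> ?L. \<not> ?prim v}"
  let ?B2 = "{(v, w) \<in> ?L \<times> ?L. \<not> ?prim w}"
  let ?B3 = "{(v, w) \<in> ?L \<times> ?L. \<not> visible d v w}"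
  note fin = finite_lattice_box[of d N]
  have finLL: "finite (?L \<times> ?L)" using fin by simp
  have cL: "real (card ?L) = ?M" by (simp add: card_lattice_box add.commute)
  have inj: "inj_on (\<lambda>(v, w). (lattice_ray d v, lattice_ray d w)) ?G"
    using lattice_ray_inj_on_primitive[of d N] by (auto simp: inj_on_def)
  have "card ?G = card ((\<lambda>(v, w). (lattice_ray d v, lattice_ray d w)) ` ?G)"
    using inj by (simp add: card_image)
  also have "\<dots> \<le> card (Psi d N)"
    by (intro card_mono finite_Psi) (auto simp: Psi_def Omega_def)
  finally have GP: "real (card ?G) \<le> real (card (Psi d N))" by simp
  \<comment> \<open>Being non-primitive is not being visible from the origin, so the count of
    invisible points applies with the origin as \<open>w\<close>.\<close>
  have prim: "real (card {v \<in> ?L. \<not> ?prim v}) \<le> ?K"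
    using assms by (intro card_not_visible_le) auto
  have B1: "real (card ?B1) \<le> ?M * ?K"
    using card_pairs_le[OF fin fin, of "\<lambda>v w. \<not> ?prim v" ?K] prim cL by simp
  have B2: "real (card ?B2) \<le> ?M * ?K"
    using card_pairs_snd_le[OF fin fin prim] cL by simp
  have vis: "real (card {v \<in> ?L. \<not> visible d v w}) \<le> ?K" if "w \<in> ?L" for w
    using assms that by (intro card_not_visible_le) (auto simp: lattice_box_def PiE_iff)
  have B3: "real (card ?B3) \<le> ?M * ?K"
    using card_pairs_le[OF fin fin, of "\<lambda>v w. \<not> visible d v w" ?K] vis cL by simp
  have LL: "real (card (?L \<times> ?L)) = ?M * ?M" by (simp add: card_cartesian_product cL)
  have "card (?L \<times> ?L) \<le> card (?G \<union> ?B1 \<union> ?B2 \<union> ?B3)"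
    by (rule card_mono) (use fin in \<open>auto intro!: finite_subset[OF _ finLL]\<close>)
  also have "\<dots> \<le> card ?G + card ?B1 + card ?B2 + card ?B3"
    by (intro order_trans[OF card_Un_le] add_mono order_refl)
  finally have "real (card (?L \<times> ?L)) \<le> real (card ?G + card ?B1 + card ?B2 + card ?B3)"
    by (simp only: of_nat_le_iff)
  then have "?M * ?M \<le> real (card ?G) + 3 * (?M * ?K)"
    using B1 B2 B3 unfolding LL of_nat_add by linarith
  also have "3 * (?M * ?K) = (15 * (2/3) ^ (d - 2)) * (?M * ?M)" by simp
  also have "\<dots> \<le> 1/2 * (?M * ?M)" using assms(3) by (intro mult_right_mono) auto
  finally show ?thesis using GP by (simp add: power2_eq_square)
qed

section \<open>Coordinate averages and the sine of the angle\<close>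

lemma sum_int_nat_interval: "(\<Sum>a\<in>{0..int N}. f a) = (\<Sum>k\<le>N. f (int k))"
proof -
  have "{0..int N} = int ` {..N}"
    by (auto simp: image_iff) (metis atMost_iff nat_0_le nat_le_iff)
  then show ?thesis by (simp add: sum.reindex)
qed

lemma sum_scaled_centred:
  assumes "N > 0"
  shows "(\<Sum>a\<in>{0..int N}. real_of_int a / N - 1/2) = 0"
proof -
  have "(\<Sum>k\<le>N. real k) = real N * (real N + 1) / 2" by (induction N) (auto simp: field_simps)
  moreover have "(\<Sum>k\<le>N. real k / N - 1/2) = (\<Sum>k\<le>N. real k) / N - (real N + 1) / 2"
    by (simp add: sum_subtractf sum_divide_distrib add.commute)
  ultimately show ?thesis unfolding sum_int_nat_interval using assms by simp
qed

text \<open>The mean of k^2/N^2 over 0 \<le> k \<le> N is (2N + 1)/(6N). The second moment bound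
  needs exact centring, so the excess 1/(6N) over 1/3 is kept here and estimated later.\<close>

lemma sum_scaled_square_centred:
  assumes "N > 0"
  shows "(\<Sum>a\<in>{0..int N}. (real_of_int a / N)\<^sup>2 - (1/3 + 1 / (6 * real N))) = 0"
proof -
  have "(\<Sum>k\<le>N. (real k)\<^sup>2) = real N * (real N + 1) * (2 * real N + 1) / 6"
    by (induction N) (auto simp: field_simps power2_eq_square)
  moreover have "(\<Sum>k\<le>N. (real k / N)\<^sup>2 - (1/3 + 1 / (6 * real N)))
      = (\<Sum>k\<le>N. (real k)\<^sup>2) / (real N)\<^sup>2 - (real N + 1) * (1/3 + 1 / (6 * real N))"
    by (simp add: sum_subtractf sum_divide_distrib power_divide add.commute)
  ultimately show ?thesis
    unfolding sum_int_nat_interval using assms by (simp add: field_simps power2_eq_square)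
qed

text \<open>Continuity at (1/4, 1/3, 1/3): the cosine there is 3/4, in the interior of the domain of
  \<open>arccos\<close>, and its sine is sqrt(1 - 9/16).\<close>

lemma sin_angle_near:
  fixes \<epsilon> :: real
  assumes "\<epsilon> > 0"
  obtains \<eta> where "\<eta> > 0"
    "\<And>p q r. \<bar>p - 1/4\<bar> \<le> \<eta> \<Longrightarrow> \<bar>q - 1/3\<bar> \<le> \<eta> \<Longrightarrow> \<bar>r - 1/3\<bar> \<le> \<eta> \<Longrightarrow>
      \<bar>sin (arccos (p / (sqrt q * sqrt r))) - sqrt 7 / 4\<bar> \<le> \<epsilon>"
proof -
  let ?F = "\<lambda>(p::real, q, r). sin (arccos (p / (sqrt q * sqrt r)))"
  have val: "?F (1/4, 1/3, 1/3) = sqrt 7 / 4"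
    by (simp add: sin_arccos power2_eq_square real_sqrt_divide)
  have "isCont ?F (1/4, 1/3, 1/3)"
    unfolding case_prod_beta by (intro continuous_intros isCont_o2[OF _ isCont_arccos]) auto
  then obtain \<delta> where \<delta>: "\<delta> > 0" "\<And>z. dist z (1/4, 1/3, 1/3) < \<delta> \<Longrightarrow> dist (?F z) (?F (1/4, 1/3, 1/3)) < \<epsilon>"
    unfolding continuous_at_eps_delta using assms by blast
  show thesis
  \<comment> \<open>The distance is at most the sum of the three deviations, hence at most 3/4 of
    \<open>\<delta>\<close> and strictly below it.\<close>
  proof (rule that[of "\<delta> / 4"])
    show "\<delta> / 4 > 0" using \<delta> by simp
    fix p q r :: real
    assume h: "\<bar>p - 1/4\<bar> \<le> \<delta> / 4" "\<bar>q - 1/3\<bar> \<le> \<delta> / 4" "\<bar>r - 1/3\<bar> \<le> \<delta> / 4"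
    have "dist (p, q, r) (1/4, 1/3, 1/3) \<le> \<bar>p - 1/4\<bar> + (\<bar>q - 1/3\<bar> + \<bar>r - 1/3\<bar>)"
      unfolding dist_Pair_Pair dist_real_def
      by (rule order_trans[OF sqrt_sum_squares_le_sum_abs])
        (auto intro: order_trans[OF sqrt_sum_squares_le_sum_abs])
    also have "\<dots> < \<delta>" using h \<delta>(1) by linarith
    finally show "\<bar>sin (arccos (p / (sqrt q * sqrt r))) - sqrt 7 / 4\<bar> \<le> \<epsilon>"
      using \<delta>(2) unfolding val by (fastforce simp: dist_real_def)
  qed
qed

text \<open>Brings the cosine into the form of \<open>sin_angle_near\<close>: angles are invariant
  under scaling by 1/N, and dividing by \<open>d\<close> cancels against the two square
  roots.\<close>

lemma vec_angle_eq_averages: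
  assumes "d > 0" "N > 0"
  shows "vec_angle d (\<lambda>i. real_of_int (v i)) (\<lambda>i. real_of_int (w i)) =
    arccos ((\<Sum>i<d. (v i / N) * (w i / N)) / d / (sqrt ((\<Sum>i<d. (v i / real N)\<^sup>2) / d) * sqrt ((\<Sum>i<d. (w i / real N)\<^sup>2) / d)))"
proof -
  have "vec_angle d (\<lambda>i. real_of_int (v i)) (\<lambda>i. real_of_int (w i)) =
      vec_angle d (\<lambda>i. v i / real N) (\<lambda>i. w i / real N)"
    by (rule vec_angle_scaled[of "real N" "real N"]) (use assms in auto)
  then show ?thesis
    using assms by (simp add: vec_angle_def L2_set_def real_sqrt_divide)
qed

lemma card_lattice_deviation_le:
  fixes \<eta> :: real
  assumes "\<eta> > 0" "d > 0"
    and "\<And>i. i < d \<Longrightarrow> (\<Sum>a\<in>{0..int N}. f i a) = (0::real)"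
    and "\<And>i a. i < d \<Longrightarrow> a \<in> {0..int N} \<Longrightarrow> \<bar>f i a\<bar> \<le> 1"
  shows "real (card {v \<in> lattice_box d N. \<bar>\<Sum>i<d. f i (v i)\<bar> > \<eta> * d}) \<le> (real N + 1) ^ d / (\<eta>\<^sup>2 * d)"
  using card_PiE_deviation_le[of "{0..int N}" \<eta> d f] assms
  by (simp add: lattice_box_def add.commute)

text \<open>Four exceptional sets, each of proportion at most
  \<open>1 / (\<eta>\<^sup>2 * d)\<close>, cover all far pairs. The tolerance is
  \<open>2 * \<eta>\<close> because two errors add up: a deviation and 1/(6N) for the squares, two
  deviations for the inner product.\<close>

lemma card_far_sin_le:
  fixes \<epsilon> \<eta> :: real
  assumes "\<eta> > 0" "d > 0" "N > 0" "1 / (6 * real N) \<le> \<eta>"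
    and near: "\<And>p q r. \<bar>p - 1/4\<bar> \<le> 2 * \<eta> \<Longrightarrow> \<bar>q - 1/3\<bar> \<le> 2 * \<eta> \<Longrightarrow> \<bar>r - 1/3\<bar> \<le> 2 * \<eta> \<Longrightarrow>
      \<bar>sin (arccos (p / (sqrt q * sqrt r))) - sqrt 7 / 4\<bar> \<le> \<epsilon>"
  shows "real (card {(v, w) \<in> lattice_box d N \<times> lattice_box d N.
      \<not> \<bar>sin (vec_angle d (\<lambda>i. real_of_int (v i)) (\<lambda>i. real_of_int (w i))) - sqrt 7 / 4\<bar> \<le> \<epsilon>})
    \<le> 4 * ((real N + 1) ^ d)\<^sup>2 / (\<eta>\<^sup>2 * d)"
proof -
  let ?L = "lattice_box d N"
  let ?M = "(real N + 1) ^ d"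
  let ?K = "?M / (\<eta>\<^sup>2 * d)"
  let ?m = "1/3 + 1 / (6 * real N)"
  let ?far = "\<lambda>v w. \<not> \<bar>sin (vec_angle d (\<lambda>i. real_of_int (v i)) (\<lambda>i. real_of_int (w i))) - sqrt 7 / 4\<bar> \<le> \<epsilon>"
  let ?P1 = "\<lambda>v w. \<bar>\<Sum>i<d. (v i / N - 1/2) * (w i / N)\<bar> > \<eta> * d"
  let ?P2 = "\<lambda>w. \<bar>\<Sum>i<d. w i / N - 1/2\<bar> > \<eta> * d"
  let ?P3 = "\<lambda>v. \<bar>\<Sum>i<d. (v i / real N)\<^sup>2 - ?m\<bar> > \<eta> * d"
  let ?B1 = "{(v, w) \<in> ?L \<times> ?L. ?P1 v w}"
  let ?B2 = "{(v, w) \<in> ?L \<times> ?L. ?P2 w}"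
  let ?B3 = "{(v, w) \<in> ?L \<times> ?L. ?P3 v}"
  let ?B4 = "{(v, w) \<in> ?L \<times> ?L. ?P3 w}"
  note fin = finite_lattice_box[of d N]
  have finLL: "finite (?L \<times> ?L)" using fin by simp
  have cL: "real (card ?L) = ?M" by (simp add: card_lattice_box add.commute)
  have unit: "0 \<le> real_of_int a / N" "real_of_int a / N \<le> 1" if "a \<in> {0..int N}" for a
    using that assms(3) by (auto simp: divide_le_eq)
  have half: "\<bar>real_of_int a / N - 1/2\<bar> \<le> 1" if "a \<in> {0..int N}" for a
    using unit[OF that] by linarith
  \<comment> \<open>For fixed \<open>w\<close> the i-th summand is a centred function of
    \<open>v i\<close> times a constant in [0, 1].\<close>
  have P1: "real (card {v \<in> ?L. ?P1 v w}) \<le> ?K" if w: "w \<in> ?L" for w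
  proof (rule card_lattice_deviation_le[OF assms(1,2)])
    show "(\<Sum>a\<in>{0..int N}. (real_of_int a / N - 1/2) * (w i / N)) = 0" if "i < d" for i
      unfolding sum_distrib_right[symmetric] using sum_scaled_centred[OF assms(3)] by simp
    show "\<bar>(real_of_int a / N - 1/2) * (w i / N)\<bar> \<le> 1" if "i < d" "a \<in> {0..int N}" for i a
    proof -
      have "w i \<in> {0..int N}" using w that(1) by (auto simp: lattice_box_def PiE_iff)
      then have "\<bar>w i / real N\<bar> \<le> 1" using unit[of "w i"] by linarith
      then show ?thesis unfolding abs_mult using half[OF that(2)] by (intro mult_le_one) auto
    qed
  qed
  have P2: "real (card {w \<in> ?L. ?P2 w}) \<le> ?K"
    by (rule card_lattice_deviation_le[OF assms(1,2)])
      (use sum_scaled_centred[OF assms(3)] half in auto)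
  have P3: "real (card {v \<in> ?L. ?P3 v}) \<le> ?K"
  proof (rule card_lattice_deviation_le[OF assms(1,2)])
    show "\<bar>(real_of_int a / N)\<^sup>2 - ?m\<bar> \<le> 1" if "a \<in> {0..int N}" for a
    proof -
      have "(real_of_int a / N)\<^sup>2 \<le> 1" using unit[OF that] by (intro power_le_one) auto
      moreover have "1 / (6 * real N) \<le> 1/6" "0 \<le> 1 / (6 * real N)" using assms(3) by (auto simp: field_simps)
      moreover have "0 \<le> (real_of_int a / N)\<^sup>2" by simp
      ultimately show ?thesis by linarith
    qed
  qed (rule sum_scaled_square_centred[OF assms(3)])
  have B1: "real (card ?B1) \<le> ?M * ?K"
    using card_pairs_le[OF fin fin, of ?P1 ?K] P1 cL by simp
  have B2: "real (card ?B2) \<le> ?M * ?K" using card_pairs_snd_le[OF fin fin P2] cL by simp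
  have B3: "real (card ?B3) \<le> ?M * ?K"
    using card_pairs_le[OF fin fin P3, unfolded cL] .
  have B4: "real (card ?B4) \<le> ?M * ?K" using card_pairs_snd_le[OF fin fin P3, unfolded cL] .
  have sq: "\<bar>(\<Sum>i<d. (v i / real N)\<^sup>2) / d - 1/3\<bar> \<le> 2 * \<eta>" if "\<not> ?P3 v" for v
  proof -
    have "(\<Sum>i<d. (v i / real N)\<^sup>2 - ?m) = (\<Sum>i<d. (v i / real N)\<^sup>2) - d * ?m"
      by (simp only: sum_subtractf sum_constant card_lessThan)
    then have "(\<Sum>i<d. (v i / real N)\<^sup>2) / d - ?m = (\<Sum>i<d. (v i / real N)\<^sup>2 - ?m) / d"
      using assms(2) by (simp only: diff_divide_distrib) simp
    also have "\<bar>\<dots>\<bar> \<le> \<eta>" using that assms(2) by (simp add: divide_le_eq)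
    finally have "\<bar>(\<Sum>i<d. (v i / real N)\<^sup>2) / d - ?m\<bar> \<le> \<eta>" .
    moreover have "0 \<le> 1 / (6 * real N)" by simp
    ultimately show ?thesis using assms(4) by linarith
  qed
  \<comment> \<open>Splitting \<open>x * y = (x - 1/2) * y + (y - 1/2) / 2 + 1/4\<close> reduces the inner product to sums that
    are centred in one point while the other is fixed.\<close>
  have sub: "{(v, w) \<in> ?L \<times> ?L. ?far v w} \<subseteq> ?B1 \<union> ?B2 \<union> ?B3 \<union> ?B4"
  proof -
    have "\<not> ?far v w" if "\<not> ?P1 v w" "\<not> ?P2 w" "\<not> ?P3 v" "\<not> ?P3 w" for v w
    proof -
      let ?X = "\<Sum>i<d. (v i / N - 1/2) * (w i / N)"
      let ?Y = "\<Sum>i<d. w i / N - 1/2"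
      have "x * y = (x - 1/2) * y + (y - 1/2) / 2 + 1/4" for x y :: real
        by (simp add: field_simps)
      then have "(\<Sum>i<d. (v i / N) * (w i / N))
          = (\<Sum>i<d. (v i / N - 1/2) * (w i / N) + (w i / N - 1/2) / 2 + 1/4)"
        by (intro sum.cong refl)
      also have "\<dots> = ?X + ?Y / 2 + d / 4"
        by (simp only: sum.distrib sum_divide_distrib[symmetric] sum_constant card_lessThan)
      finally have S: "(\<Sum>i<d. (v i / N) * (w i / N)) = ?X + ?Y / 2 + d / 4" .
      have "(\<Sum>i<d. (v i / N) * (w i / N)) / d - 1/4 = ?X / d + ?Y / d / 2"
        unfolding S using assms(2) by (simp only: add_divide_distrib) simp
      moreover have "\<bar>?X / d\<bar> \<le> \<eta>" "\<bar>?Y / d\<bar> \<le> \<eta>"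
        using that(1,2) assms(2) by (simp_all add: divide_le_eq)
      moreover have "\<bar>z\<bar> \<le> 2 * \<eta>" if "z = x + y / 2" "\<bar>x\<bar> \<le> \<eta>" "\<bar>y\<bar> \<le> \<eta>" for x y z
        using that by linarith
      ultimately have "\<bar>(\<Sum>i<d. (v i / N) * (w i / N)) / d - 1/4\<bar> \<le> 2 * \<eta>" by blast
      from near[OF this sq[OF that(3)] sq[OF that(4)]] show ?thesis
        unfolding vec_angle_eq_averages[OF assms(2,3)] by simp
    qed
    then show ?thesis by blast
  qed
  have "card {(v, w) \<in> ?L \<times> ?L. ?far v w} \<le> card (?B1 \<union> ?B2 \<union> ?B3 \<union> ?B4)"
    by (rule card_mono[OF _ sub]) (auto intro!: finite_subset[OF _ finLL])
  also have "\<dots> \<le> card ?B1 + card ?B2 + card ?B3 + card ?B4"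
    by (intro order_trans[OF card_Un_le] add_mono order_refl)
  finally have "real (card {(v, w) \<in> ?L \<times> ?L. ?far v w}) \<le> real (card ?B1 + card ?B2 + card ?B3 + card ?B4)"
    by (simp only: of_nat_le_iff)
  also have "\<dots> \<le> 4 * (?M * ?K)" using B1 B2 B3 B4 unfolding of_nat_add by linarith
  finally show ?thesis by (simp add: power2_eq_square)
qed

section \<open>Choice of the constant and comparison of the two counts\<close>

theorem theorem3:
  fixes \<epsilon> :: real
  assumes "\<epsilon> > 0"
  shows "\<exists>C::nat. C \<ge> 3 \<and> (\<forall>d N :: nat. d \<ge> C \<longrightarrow> N \<ge> C * d \<longrightarrow>
    1 / real (card (Psi d N)) *
      real (card {(R, S) \<in> Psi d N.
        sin (ray_angle d R S) \<in> {sqrt 7 / 4 - \<epsilon> .. sqrt 7 / 4 + \<epsilon>}}) \<ge> 1 - \<epsilon>)"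
proof -
  obtain \<eta>0 where \<eta>0: "\<eta>0 > 0"
    "\<And>p q r. \<bar>p - 1/4\<bar> \<le> \<eta>0 \<Longrightarrow> \<bar>q - 1/3\<bar> \<le> \<eta>0 \<Longrightarrow> \<bar>r - 1/3\<bar> \<le> \<eta>0 \<Longrightarrow>
      \<bar>sin (arccos (p / (sqrt q * sqrt r))) - sqrt 7 / 4\<bar> \<le> \<epsilon>"
    using sin_angle_near[OF assms] by blast
  \<comment> \<open>Halved because \<open>card_far_sin_le\<close> works with tolerance
    \<open>2 * \<eta>\<close>.\<close>
  define \<eta> where "\<eta> = \<eta>0 / 2"
  have \<eta>: "\<eta> > 0" using \<eta>0(1) by (simp add: \<eta>_def)
  have "(\<lambda>n. 15 * (2/3 :: real) ^ n) \<longlonglongrightarrow> 15 * 0"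
    by (intro tendsto_intros LIMSEQ_realpow_zero) auto
  then have "\<forall>\<^sub>F n in sequentially. 15 * (2/3 :: real) ^ n < 1/2"
    by (rule order_tendstoD(2)) simp
  then obtain n0 where n0: "\<And>n. n \<ge> n0 \<Longrightarrow> 15 * (2/3 :: real) ^ n < 1/2"
    unfolding eventually_sequentially by blast
  \<comment> \<open>The first two summands give d - 2 \<ge> n0, as the lower bound for
    \<open>Psi d N\<close> requires; the third gives 1/(6N) \<le> \<eta>; the last makes the far
    pairs of points at most \<open>\<epsilon>\<close> times that lower bound.\<close>
  define C where "C = 3 + n0 + nat \<lceil>1 / \<eta>\<rceil> + nat \<lceil>8 / (\<eta>\<^sup>2 * \<epsilon>)\<rceil>"
  have C\<eta>: "1 / \<eta> \<le> C" and C\<epsilon>: "8 / (\<eta>\<^sup>2 * \<epsilon>) \<le> C" unfolding C_def by linarith+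
  show ?thesis
  proof (intro exI[of _ C] conjI allI impI)
    show "C \<ge> 3" by (simp add: C_def)
    fix d N :: nat assume d: "d \<ge> C" and "N \<ge> C * d"
    moreover have C3: "C \<ge> 3" by (simp add: C_def)
    moreover have "C * 1 \<le> C * d" using d C3 by (intro mult_left_mono) auto
    ultimately have NC: "N \<ge> C" by linarith
    let ?L = "lattice_box d N"
    let ?M = "(real N + 1) ^ d"
    let ?near = "\<lambda>R S. sin (ray_angle d R S) \<in> {sqrt 7 / 4 - \<epsilon> .. sqrt 7 / 4 + \<epsilon>}"
    let ?Good = "{(R, S) \<in> Psi d N. ?near R S}"
    let ?Bad = "{(R, S) \<in> Psi d N. \<not> ?near R S}"
    let ?D = "{(v, w) \<in> ?L \<times> ?L.
      \<not> \<bar>sin (vec_angle d (\<lambda>i. real_of_int (v i)) (\<lambda>i. real_of_int (w i))) - sqrt 7 / 4\<bar> \<le> \<epsilon>}"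
    have Psi: "real (card (Psi d N)) \<ge> ?M\<^sup>2 / 2"
      using d NC C3 by (intro card_Psi_ge less_imp_le n0) (auto simp: C_def)
    have pos: "?M\<^sup>2 / 2 > 0" by simp
    have "1 / \<eta> \<le> 6 * real N" using C\<eta> NC by linarith
    then have N\<eta>: "1 / (6 * real N) \<le> \<eta>" using \<eta> NC C3 by (simp add: field_simps)
    have D: "real (card ?D) \<le> 4 * ?M\<^sup>2 / (\<eta>\<^sup>2 * d)"
      using d NC C3 \<eta>0 \<eta> N\<eta> by (intro card_far_sin_le) (auto simp: \<eta>_def)
    have "8 / (\<eta>\<^sup>2 * \<epsilon>) \<le> d" using C\<epsilon> d by linarith
    then have "8 / (\<eta>\<^sup>2 * d) \<le> \<epsilon>" using \<eta> assms d C3 by (simp add: field_simps)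
    then have "8 / (\<eta>\<^sup>2 * d) * (?M\<^sup>2 / 2) \<le> \<epsilon> * (?M\<^sup>2 / 2)" using pos by (intro mult_right_mono) auto
    moreover have eq: "4 * x / y = 8 / y * (x / 2)" for x y :: real by simp
    ultimately have D': "real (card ?D) \<le> \<epsilon> * (?M\<^sup>2 / 2)"
      by (intro order_trans[OF D]) (simp only: eq)
    have "finite ?D" by (rule finite_subset[of _ "?L \<times> ?L"]) (auto simp: finite_lattice_box)
    \<comment> \<open>By \<open>ray_angle_ray\<close> the angle can be read off from any points
      spanning the rays. Visibility is dropped in \<open>?D\<close>, which only enlarges the
      bound.\<close>
    moreover have "?Bad \<subseteq> (\<lambda>(v, w). (lattice_ray d v, lattice_ray d w)) ` ?D"
    proof clarify
      fix R S assume "(R, S) \<in> Psi d N" and far: "\<not> ?near R S"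
      then obtain v w where vw: "(v, w) \<in> Omega d N" "R = lattice_ray d v" "S = lattice_ray d w"
        by (auto simp: Psi_def)
      then have "(v, w) \<in> ?D"
        using far by (auto simp: Omega_def lattice_ray_def ray_angle_ray abs_le_iff)
      then show "(R, S) \<in> (\<lambda>(v, w). (lattice_ray d v, lattice_ray d w)) ` ?D"
        using vw(2,3) by (metis (mono_tags, lifting) case_prod_conv image_eqI)
    qed
    ultimately have "card ?Bad \<le> card ?D" by (rule surj_card_le)
    with D' have "real (card ?Bad) \<le> \<epsilon> * (?M\<^sup>2 / 2)" by linarith
    \<comment> \<open>The lower bound for \<open>Psi d N\<close> turns a proportion of pairs of
      points into a proportion of pairs of rays.\<close>
    also have "\<dots> \<le> \<epsilon> * card (Psi d N)" using Psi assms by (intro mult_left_mono) auto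
    finally have Bad: "real (card ?Bad) \<le> \<epsilon> * card (Psi d N)" .
    have "card (Psi d N) = card (?Good \<union> ?Bad)" by (rule arg_cong[where f = card]) auto
    also have "\<dots> \<le> card ?Good + card ?Bad" by (rule card_Un_le)
    finally have "(1 - \<epsilon>) * card (Psi d N) \<le> card ?Good" using Bad by (simp add: algebra_simps)
    moreover have "real (card (Psi d N)) > 0" using Psi pos by linarith
    ultimately show "1 / real (card (Psi d N)) * real (card ?Good) \<ge> 1 - \<epsilon>"
      by (simp add: pos_le_divide_eq)
  qed
qed

end
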